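(* Let $n\ge1$ and $k\ge1$ be fixed integers with $k\le n/2$. There exists a tight $(k,k)$-design in $F_2^n$ if and only if there exists a tight $(2k+1)$-design in $F_2^n$.
   Context: $F_2^n$ is the set of binary vectors of length $n$, with Hamming distance $d(x,y)$, and $\langle x,y\rangle:=1-\frac{2d(x,y)}{n}$. The Krawtchouk polynomials $Q_i^{(n)}(t)$ are defined by $Q_0^{(n)}=1$, $Q_1^{(n)}(t)=t$, $ntQ_i^{(n)}(t)=(n-i)Q_{i+1}^{(n)}(t)+iQ_{i-1}^{(n)}(t)$ for $1\le i\le n-1$. For a nonempty $C\subseteq F_2^n$ the moments are $M_i(C):=\sum_{x,y\in C}Q_i^{(n)}(\langle x,y\rangle)$ (over all ordered pairs, including $x=y$). $C$ is an $m$-design ($1\le m\le n$) if $M_i(C)=0$ for $i=1,\dots,m$ (equivalently, a binary orthogonal array of strength $m$: any $m$ columns of the codeword matrix contain each $m$-tuple equally often). $C$ is a $(k,k)$-design if $M_i(C)=0$ for $i=2,4,\dots,2k$. A $(k,k)$-design is tight if its cardinality equals $\sum_{i=0}^k\binom{n-1}{i}$. A $(2k+1)$-design is tight if its cardinality equals the Rao bound $2\sum_{i=0}^k\binom{n-1}{i}$.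
   Formalization: When 2k = n, a (2k+1)-design is undefined (m-designs need m ≤ n); there it is read as a nonempty C with M_i(C) = 0 for all i = 1,…,n. If no such designs were admitted, the claim would fail for n = 2, k = 1. All cases with 2k+1 ≤ n are as stated. *)

theory Defs
  imports "HOL-Analysis.Analysis" "HOL-Library.Z2"
begin

text \<open>
  The space \<open>F\<^sub>2\<^sup>n\<close> is \<open>bit ^ 'n\<close> with \<open>n = CARD('n)\<close>; since types are nonempty, \<open>n \<ge> 1\<close>.
\<close>

instance bit :: finite
proof
  have "(UNIV :: bit set) \<subseteq> {0, 1}"
    by auto
  then show "finite (UNIV :: bit set)"
    by (rule finite_subset) simp
qed

definition hamming_dist :: "bit ^ 'n \<Rightarrow> bit ^ 'n \<Rightarrow> nat" where
  "hamming_dist x y = card {j. x $ j \<noteq> y $ j}"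

definition ham_inner :: "bit ^ 'n \<Rightarrow> bit ^ 'n \<Rightarrow> real" where
  "ham_inner x y = 1 - 2 * real (hamming_dist x y) / real CARD('n)"

text \<open>
  The three-term recurrence, solved for the highest index; see \<open>krawtchouk_recurrence\<close>.
  The value is meaningful only for indices \<open>i \<le> n\<close> (beyond that, the recurrence
  divides by zero or leaves the range in which it is imposed).
\<close>

fun krawtchouk :: "nat \<Rightarrow> nat \<Rightarrow> real \<Rightarrow> real" where
  "krawtchouk n 0 t = 1"
| "krawtchouk n (Suc 0) t = t"
| "krawtchouk n (Suc (Suc i)) t =
     (real n * t * krawtchouk n (Suc i) t - real (Suc i) * krawtchouk n i t)
       / (real n - real (Suc i))"

lemma krawtchouk_recurrence:
  assumes "1 \<le> i" "i \<le> n - 1"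
  shows "real n * t * krawtchouk n i t =
    real (n - i) * krawtchouk n (i + 1) t + real i * krawtchouk n (i - 1) t"
proof -
  from assms obtain j where j: "i = Suc j" "Suc j < n"
    by (cases i) auto
  then have "real n - real (Suc j) \<noteq> 0"
    by simp
  then show ?thesis
    using j by (simp add: of_nat_diff)
qed

definition moment :: "nat \<Rightarrow> (bit ^ 'n) set \<Rightarrow> real" where
  "moment i C = (\<Sum>x\<in>C. \<Sum>y\<in>C. krawtchouk CARD('n) i (ham_inner x y))"

text \<open>
  \<open>Q\<^sub>i\<close>, hence the \<open>i\<close>-th moment, is defined only for \<open>i \<le> n\<close>, and \<open>m\<close>-designs are usually
  considered for \<open>1 \<le> m \<le> n\<close> only; there the guard \<open>i \<le> CARD('n)\<close> is redundant. It gives a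
  meaning to \<open>(2 k + 1)\<close>-designs in the boundary case \<open>2 k = n\<close>: all moments that exist vanish.
\<close>

definition is_design :: "nat \<Rightarrow> (bit ^ 'n) set \<Rightarrow> bool" where
  "is_design m C \<longleftrightarrow>
     C \<noteq> {} \<and> (\<forall>i\<in>{1..m}. i \<le> CARD('n) \<longrightarrow> moment i C = 0)"

definition is_kk_design :: "nat \<Rightarrow> (bit ^ 'n) set \<Rightarrow> bool" where
  "is_kk_design k C \<longleftrightarrow> C \<noteq> {} \<and> (\<forall>i\<in>{1..k}. moment (2 * i) C = 0)"

definition tight_kk_design :: "nat \<Rightarrow> (bit ^ 'n) set \<Rightarrow> bool" where
  "tight_kk_design k C \<longleftrightarrow>
     is_kk_design k C \<and> card C = (\<Sum>i=0..k. (CARD('n) - 1) choose i)"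

text \<open>The first argument is \<open>k\<close>, not the strength \<open>2 k + 1\<close>.\<close>

definition tight_odd_design :: "nat \<Rightarrow> (bit ^ 'n) set \<Rightarrow> bool" where
  "tight_odd_design k C \<longleftrightarrow>
     is_design (2 * k + 1) C \<and> card C = 2 * (\<Sum>i=0..k. (CARD('n) - 1) choose i)"

end

theory Submission
  imports Defs
begin

text \<open>
  By the addition formula, \<open>M\<^sub>i(C)\<close> is a positive multiple of the sum of the squares of the
  character sums of \<open>C\<close> over all characters of weight \<open>i\<close>, so designs are described by vanishing
  character sums. Let \<open>S\<close> be the number of characters of weight at most \<open>k\<close> whose weight has the
  parity of \<open>k\<close>; it equals \<open>\<Sum>i\<le>k. n - 1 choose i\<close>. Their reproducing kernel \<open>K\<close> has diagonal
  value \<open>S\<close> and value \<open>\<plusminus>S\<close> at antipodal pairs, and products of two such characters have even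
  weight at most \<open>2k\<close>. Hence \<open>\<Sum>y\<in>C. K(x,y)\<^sup>2 = S |C|\<close> for a \<open>(k,k)\<close>-design \<open>C\<close>.

  If \<open>|C| = S\<close>, the term \<open>y = x\<close> exhausts the sum, so \<open>C\<close> contains no antipodal pair, and the union
  of \<open>C\<close> with its antipode is a tight \<open>(2k+1)\<close>-design. If \<open>C\<close> is a \<open>(2k+1)\<close>-design and \<open>|C| = 2S\<close>,
  then also \<open>\<Sum>y\<in>C. (1 + \<langle>x,y\<rangle>) K(x,y)\<^sup>2 = 2S\<^sup>2\<close>, which is exhausted by \<open>y = x\<close>. So \<open>K(x,y) = 0\<close>
  unless \<open>y\<close> is \<open>x\<close> or its antipode, and the first identity forces the antipode into \<open>C\<close>. The half
  of \<open>C\<close> with a fixed coordinate equal to \<open>0\<close> is then a tight \<open>(k,k)\<close>-design.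
\<close>

section \<open>Characters\<close>

definition bsign :: "bit ^ 'n \<Rightarrow> 'n \<Rightarrow> real" where
  "bsign x j = (if x $ j = 0 then 1 else - 1)"

text \<open>The Walsh characters of the additive group, indexed by their supports, so that
  \<open>card w\<close> is the weight of the character.\<close>

definition chi :: "'n set \<Rightarrow> bit ^ 'n \<Rightarrow> real" where
  "chi w x = (\<Prod>j\<in>w. bsign x j)"

lemma bsign_mult_self [simp]: "bsign x j * bsign x j = 1"
  by (simp add: bsign_def)

lemma bsign_add: "bsign (x + y) j = bsign x j * bsign y j"
  by (cases "x $ j"; cases "y $ j") (simp_all add: bsign_def)

text \<open>Here \<open>1\<close> is the all-ones vector, so \<open>x + 1\<close> is the antipode of
  \<open>x\<close>.\<close>

lemma bsign_antipode: "bsign (x + 1) j = - bsign x j"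
  by (cases "x $ j") (simp_all add: bsign_def)

lemma antipode_antipode [simp]: "x + 1 + 1 = (x :: bit ^ 'n)"
  by (simp add: vec_eq_iff add.assoc)

lemma chi_empty [simp]: "chi {} x = 1"
  by (simp add: chi_def)

lemma chi_singleton: "chi {j} x = bsign x j"
  by (simp add: chi_def)

lemma chi_mult_self [simp]: "chi w x * chi w x = 1"
  by (simp add: chi_def flip: prod.distrib)

lemma chi_add: "chi w (x + y) = chi w x * chi w y"
  by (simp add: chi_def bsign_add prod.distrib)

lemma chi_antipode: "chi w (x + 1) = (- 1) ^ card w * chi w x"
  for x :: "bit ^ 'n::finite"
proof -
  have "chi w (x + 1) = (\<Prod>j\<in>w. (- 1) * bsign x j)"
    by (simp add: chi_def bsign_antipode)
  then show ?thesis
    by (simp only: prod.distrib prod_constant chi_def)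
qed

text \<open>Coordinates in \<open>w \<inter> v\<close> enter the product twice, and the square of a
  sign is 1.\<close>

lemma chi_sym_diff: "chi (sym_diff w v) x = chi w x * chi v x"
  for x :: "bit ^ 'n::finite"
proof -
  have split: "chi u x = chi (u - u') x * chi (u \<inter> u') x" for u u'
    using prod.subset_diff[of "u \<inter> u'" u "bsign x"] by (simp add: chi_def Diff_Int)
  have "chi w x * chi v x =
      (chi (w - v) x * chi (w \<inter> v) x) * (chi (v - w) x * chi (w \<inter> v) x)"
    using split[of w v] split[of v w] by (simp add: Int_commute)
  also have "\<dots> = chi (w - v) x * chi (v - w) x * (chi (w \<inter> v) x * chi (w \<inter> v) x)"
    by (simp only: mult_ac)
  also have "\<dots> = chi (w - v) x * chi (v - w) x"
    by simp
  also have "\<dots> = chi (sym_diff w v) x"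
    by (simp add: chi_def prod.union_disjoint disjoint_iff)
  finally show ?thesis ..
qed

lemma card_sym_diff: "card (sym_diff w v) + 2 * card (w \<inter> v) = card w + card v"
  if "finite w" "finite v"
proof -
  have "card (sym_diff w v) = card (w - v) + card (v - w)"
    using that by (intro card_Un_disjoint) auto
  moreover have "card w = card (w - v) + card (w \<inter> v)" "card v = card (v - w) + card (w \<inter> v)"
    using that by (metis add.commute card_Int_Diff Int_commute)+
  ultimately show ?thesis
    by simp
qed

section \<open>The addition formula\<close>

text \<open>An unnormalised Krawtchouk polynomial: at \<open>x + y\<close> it is binomial(n, i)
  times the value of Q_i at \<open>ham_inner x y\<close>.\<close>

definition level_sum :: "nat \<Rightarrow> bit ^ 'n \<Rightarrow> real" where
  "level_sum i z = (\<Sum>w | card w = i. chi w z)"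

lemma sum_bsign: "(\<Sum>j\<in>UNIV. bsign (x + y) j) = real CARD('n) * ham_inner x y"
  for x y :: "bit ^ 'n::finite"
proof -
  have "bsign (x + y) j = 1 - 2 * of_bool (x $ j \<noteq> y $ j)" for j
    by (cases "x $ j"; cases "y $ j") (simp_all add: bsign_def)
  then have "(\<Sum>j\<in>UNIV. bsign (x + y) j) = real CARD('n) - 2 * real (hamming_dist x y)"
    by (simp add: sum_subtractf hamming_dist_def flip: sum_distrib_left)
  also have "\<dots> = real CARD('n) * ham_inner x y"
    by (simp add: ham_inner_def right_diff_distrib)
  finally show ?thesis .
qed

lemma level_sum_0 [simp]: "level_sum 0 z = 1" for z :: "bit ^ 'n::finite"
proof -
  have "{w :: 'n set. card w = 0} = {{}}"
    by auto
  then show ?thesis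
    by (simp add: level_sum_def)
qed

lemma sum_outside_level:
  "(\<Sum>(w, j) | card w = i \<and> j \<notin> w. chi w z) = real (CARD('n) - i) * level_sum i z"
  for z :: "bit ^ 'n::finite"
proof -
  have Sigma: "{(w, j). card w = i \<and> j \<notin> w} = (SIGMA w:{w. card w = i}. - w)"
    by auto
  have "(\<Sum>(w, j) | card w = i \<and> j \<notin> w. chi w z) =
      (\<Sum>w | card w = i. \<Sum>j\<in>-w. chi w z)"
    unfolding Sigma by (subst sum.Sigma) simp_all
  also have "\<dots> = (\<Sum>w | card w = i. real (CARD('n) - i) * chi w z)"
    by (intro sum.cong refl) (simp add: Compl_eq_Diff_UNIV card_Diff_subset)
  finally show ?thesis
    by (simp add: level_sum_def sum_distrib_left)
qed

lemma sum_inside_level: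
  "(\<Sum>(w, j) | card w = i \<and> j \<in> w. chi w z) = real i * level_sum i z"
  for z :: "bit ^ 'n::finite"
proof -
  have Sigma: "{(w, j). card w = i \<and> j \<in> w} = (SIGMA w:{w. card w = i}. w)"
    by auto
  have "(\<Sum>(w, j) | card w = i \<and> j \<in> w. chi w z) =
      (\<Sum>w | card w = i. \<Sum>j\<in>w. chi w z)"
    unfolding Sigma by (subst sum.Sigma) simp_all
  also have "\<dots> = (\<Sum>w | card w = i. real i * chi w z)"
    by (intro sum.cong refl) simp
  finally show ?thesis
    by (simp add: level_sum_def sum_distrib_left)
qed

text \<open>Multiplying \<open>chi w z\<close> by \<open>bsign z j\<close> deletes \<open>j\<close>
  from \<open>w\<close> or inserts it. From sets of size i + 1, each set of size i arises n - i
  times and each set of size i + 2 arises i + 2 times.\<close>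

lemma level_sum_recurrence:
  "level_sum (Suc i) z * (\<Sum>j\<in>UNIV. bsign z j) =
     real (Suc (Suc i)) * level_sum (Suc (Suc i)) z + real (CARD('n) - i) * level_sum i z"
  for z :: "bit ^ 'n::finite"
proof -
  let ?g = "\<lambda>(w, j). chi w z * bsign z j"
  let ?In = "{(w :: 'n set, j). card w = Suc i \<and> j \<in> w}"
  let ?Out = "{(w :: 'n set, j). card w = Suc i \<and> j \<notin> w}"
  have "?In \<union> ?Out = {w. card w = Suc i} \<times> UNIV" "?In \<inter> ?Out = {}"
    by auto
  then have "level_sum (Suc i) z * (\<Sum>j\<in>UNIV. bsign z j) = sum ?g ?In + sum ?g ?Out"
    by (simp add: level_sum_def sum_product sum.cartesian_product
        flip: sum.union_disjoint)
  also have "sum ?g ?In = (\<Sum>(w, j) | card w = i \<and> j \<notin> w. chi w z)"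
    by (rule sum.reindex_bij_witness[where i = "\<lambda>(w, j). (insert j w, j)"
          and j = "\<lambda>(w, j). (w - {j}, j)"])
      (auto simp: insert_absorb chi_def prod.remove mult_ac)
  also have "sum ?g ?Out = (\<Sum>(w, j) | card w = Suc (Suc i) \<and> j \<in> w. chi w z)"
    by (rule sum.reindex_bij_witness[where i = "\<lambda>(w, j). (w - {j}, j)"
          and j = "\<lambda>(w, j). (insert j w, j)"])
      (auto simp: insert_absorb chi_def mult_ac)
  finally show ?thesis
    by (simp only: sum_inside_level sum_outside_level add.commute)
qed

text \<open>Both sides start alike and obey the same three-term recurrence once the binomial
  coefficients are absorbed.\<close>

lemma binomial_krawtchouk:
  fixes x y :: "bit ^ 'n::finite"
  assumes "i \<le> CARD('n)"
  shows "real (CARD('n) choose i) * krawtchouk CARD('n) i (ham_inner x y) = level_sum i (x + y)"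
  using assms
proof (induction i rule: induct_nat_012)
  case 0
  then show ?case
    by simp
next
  case 1
  have "{w :: 'n set. card w = Suc 0} = range (\<lambda>j. {j})"
    by (auto simp: card_Suc_eq)
  then have "level_sum (Suc 0) (x + y) = (\<Sum>j\<in>UNIV. bsign (x + y) j)"
    by (simp add: level_sum_def sum.reindex inj_on_def chi_singleton)
  then show ?case
    by (simp add: sum_bsign)
next
  case (ge2 i)
  let ?n = "CARD('n)"
  let ?t = "ham_inner x y"
  let ?Q = "\<lambda>i. krawtchouk ?n i ?t"
  have choose: "Suc i * (?n choose Suc i) = (?n - i) * (?n choose i)" for i
    by (simp only: binomial_absorption binomial_absorb_comp)
  have choose1: "real (Suc i) * real (?n choose Suc i) = real (?n - i) * real (?n choose i)"
    by (metis choose of_nat_mult)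
  have choose2: "real (Suc (Suc i)) * real (?n choose Suc (Suc i)) =
      (real ?n - real (Suc i)) * real (?n choose Suc i)"
    using ge2.prems by (metis Suc_leD choose of_nat_diff of_nat_mult)
  have IH: "level_sum i (x + y) = real (?n choose i) * ?Q i"
    "level_sum (Suc i) (x + y) = real (?n choose Suc i) * ?Q (Suc i)"
    using ge2 by simp_all
  \<comment> \<open>Since i + 2 \<le> n, the divisor in the definition of \<open>krawtchouk\<close>
    is nonzero.\<close>
  have rec: "real ?n * ?t * ?Q (Suc i) =
      (real ?n - real (Suc i)) * ?Q (Suc (Suc i)) + real (Suc i) * ?Q i"
    using ge2.prems by simp
  have "real (Suc (Suc i)) * level_sum (Suc (Suc i)) (x + y) =
      real ?n * ?t * (real (?n choose Suc i) * ?Q (Suc i))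
      - real (?n - i) * (real (?n choose i) * ?Q i)"
    using level_sum_recurrence[of i "x + y"] unfolding sum_bsign IH by (simp only: mult_ac)
  also have "\<dots> = real (?n choose Suc i) * (real ?n * ?t * ?Q (Suc i) - real (Suc i) * ?Q i)"
    using choose1 by algebra
  also have "\<dots> = real (?n choose Suc i) * ((real ?n - real (Suc i)) * ?Q (Suc (Suc i)))"
    unfolding rec by simp
  also have "\<dots> = real (Suc (Suc i)) * (real (?n choose Suc (Suc i)) * ?Q (Suc (Suc i)))"
    using choose2 by algebra
  finally show ?case
    by (metis mult_left_cancel of_nat_eq_0_iff nat.distinct(1))
qed

section \<open>Designs and character sums\<close>

definition char_sum :: "'n set \<Rightarrow> (bit ^ 'n) set \<Rightarrow> real" where
  "char_sum w C = (\<Sum>x\<in>C. chi w x)"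

text \<open>By \<open>chi_add\<close> the summand splits into a factor in \<open>x\<close> and one
  in \<open>y\<close>, so the double sum over pairs is a square for each character.\<close>

lemma moment_eq_sum_char_sum:
  fixes C :: "(bit ^ 'n::finite) set"
  assumes "i \<le> CARD('n)"
  shows "real (CARD('n) choose i) * moment i C = (\<Sum>w | card w = i. (char_sum w C)\<^sup>2)"
proof -
  have "real (CARD('n) choose i) * moment i C = (\<Sum>x\<in>C. \<Sum>y\<in>C. level_sum i (x + y))"
    using assms by (simp add: moment_def sum_distrib_left binomial_krawtchouk)
  also have "\<dots> = (\<Sum>x\<in>C. \<Sum>w | card w = i. \<Sum>y\<in>C. chi w x * chi w y)"
    unfolding level_sum_def chi_add by (intro sum.cong refl sum.swap)
  also have "\<dots> = (\<Sum>w | card w = i. \<Sum>x\<in>C. \<Sum>y\<in>C. chi w x * chi w y)"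
    by (rule sum.swap)
  finally show ?thesis
    by (simp add: char_sum_def power2_eq_square sum_product)
qed

lemma moment_eq_0_iff:
  fixes C :: "(bit ^ 'n::finite) set"
  assumes "i \<le> CARD('n)"
  shows "moment i C = 0 \<longleftrightarrow> (\<forall>w. card w = i \<longrightarrow> char_sum w C = 0)"
proof -
  have "moment i C = 0 \<longleftrightarrow> (\<Sum>w | card w = i. (char_sum w C)\<^sup>2) = 0"
    using moment_eq_sum_char_sum[OF assms, of C] assms
    by (metis binomial_eq_0_iff mult_eq_0_iff not_le of_nat_eq_0_iff)
  then show ?thesis
    by (simp add: sum_nonneg_eq_0_iff)
qed

lemma is_design_iff:
  fixes C :: "(bit ^ 'n::finite) set"
  shows "is_design m C \<longleftrightarrow>
    C \<noteq> {} \<and> (\<forall>w. w \<noteq> {} \<longrightarrow> card w \<le> m \<longrightarrow> char_sum w C = 0)"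
proof -
  have "(\<forall>i\<in>{1..m}. i \<le> CARD('n) \<longrightarrow> moment i C = 0) \<longleftrightarrow>
      (\<forall>w. w \<noteq> {} \<longrightarrow> card w \<le> m \<longrightarrow> char_sum w C = 0)" (is "?L \<longleftrightarrow> ?R")
  proof
    assume ?L
    show ?R
    proof (intro allI impI)
      fix w :: "'n set"
      assume "w \<noteq> {}" "card w \<le> m"
      \<comment> \<open>This discharges the guard \<open>i \<le> CARD('n)\<close> of
        \<open>is_design\<close>, also when \<open>m\<close> exceeds n.\<close>
      moreover have "card w \<le> CARD('n)"
        by (simp add: card_mono)
      ultimately show "char_sum w C = 0"
        using \<open>?L\<close> moment_eq_0_iff[of "card w" C] by (simp add: Suc_le_eq card_gt_0_iff)
    qed
  next
    assume ?R
    show ?L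
    proof (intro ballI impI)
      fix i assume "i \<in> {1..m}" "i \<le> CARD('n)"
      moreover have "char_sum w C = 0" if "card w = i" for w
        using \<open>?R\<close> that \<open>i \<in> {1..m}\<close> by (metis atLeastAtMost_iff card.empty not_one_le_zero)
      ultimately show "moment i C = 0"
        by (simp add: moment_eq_0_iff)
    qed
  qed
  then show ?thesis
    by (simp add: is_design_def)
qed

lemma is_kk_design_iff:
  fixes C :: "(bit ^ 'n::finite) set"
  assumes "2 * k \<le> CARD('n)"
  shows "is_kk_design k C \<longleftrightarrow>
    C \<noteq> {} \<and> (\<forall>w. w \<noteq> {} \<longrightarrow> even (card w) \<longrightarrow> card w \<le> 2 * k \<longrightarrow> char_sum w C = 0)"
proof -
  have "(\<forall>i\<in>{1..k}. moment (2 * i) C = 0) \<longleftrightarrow>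
      (\<forall>w. w \<noteq> {} \<longrightarrow> even (card w) \<longrightarrow> card w \<le> 2 * k \<longrightarrow> char_sum w C = 0)" (is "?L \<longleftrightarrow> ?R")
  proof
    assume ?L
    show ?R
    proof (intro allI impI)
      fix w :: "'n set"
      assume w: "w \<noteq> {}" "even (card w)" "card w \<le> 2 * k"
      then obtain i where i: "card w = 2 * i"
        by blast
      have "card w > 0"
        using w by (simp add: card_gt_0_iff)
      then have "i \<in> {1..k}"
        using w i by simp
      then show "char_sum w C = 0"
        using \<open>?L\<close> moment_eq_0_iff[of "2 * i" C] i assms by simp
    qed
  next
    assume ?R
    show ?L
    proof
      fix i assume i: "i \<in> {1..k}"
      have "char_sum w C = 0" if "card w = 2 * i" for w
      proof -
        have "w \<noteq> {}"
          using i that by auto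
        then show ?thesis
          using \<open>?R\<close> i that by simp
      qed
      then show "moment (2 * i) C = 0"
        using assms i by (simp add: moment_eq_0_iff)
    qed
  qed
  then show ?thesis
    by (simp add: is_kk_design_def)
qed

text \<open>In the union of a set with a disjoint antipodal copy, odd weights therefore cancel and
  even weights double.\<close>

lemma char_sum_antipode:
  "char_sum w ((\<lambda>x. x + 1) ` C) = (- 1) ^ card w * char_sum w C"
  for C :: "(bit ^ 'n::finite) set"
  by (simp add: char_sum_def sum.reindex inj_on_def chi_antipode sum_distrib_left)

lemma is_design_imp_is_kk_design:
  "is_design (2 * k + 1) C \<Longrightarrow> 2 * k \<le> CARD('n) \<Longrightarrow> is_kk_design k C"
  for C :: "(bit ^ 'n::finite) set"
  by (auto simp: is_design_iff is_kk_design_iff)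

section \<open>The parity_kernel\<close>

text \<open>Fixing the parity of the weight makes every product of two of these characters have even
  weight, the only weights that a (k,k)-design controls.\<close>

definition parity_level :: "nat \<Rightarrow> 'n set set" where
  "parity_level k = {w. card w \<le> k \<and> even (card w + k)}"

definition parity_kernel :: "nat \<Rightarrow> bit ^ 'n \<Rightarrow> bit ^ 'n \<Rightarrow> real" where
  "parity_kernel k x y = (\<Sum>w\<in>parity_level k. chi w x * chi w y)"

lemma card_subsets_UNIV: "card {w :: 'n::finite set. card w = i} = CARD('n) choose i"
  using n_subsets[of "UNIV :: 'n set" i] by simp

text \<open>Passing from k to k + 2 adds the sets of size k + 2; Pascal's rule splits their number
  into the two new summands on the right.\<close>

lemma card_parity_level:
  "card (parity_level k :: 'n::finite set set) = (\<Sum>i=0..k. (CARD('n) - 1) choose i)"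
proof (induction k rule: induct_nat_012)
  case 0
  have "(parity_level 0 :: 'n set set) = {{}}"
    by (auto simp: parity_level_def)
  then show ?case
    by simp
next
  case 1
  have "(parity_level (Suc 0) :: 'n set set) = {w. card w = 1}"
    by (auto simp: parity_level_def le_Suc_eq)
  then show ?case
    by (simp add: card_subsets_UNIV Suc_leI)
next
  case (ge2 k)
  obtain m where m: "CARD('n) = Suc m"
    by (metis zero_less_card_finite gr0_implies_Suc)
  have "(parity_level (Suc (Suc k)) :: 'n set set) =
      parity_level k \<union> {w. card w = Suc (Suc k)}"
    by (auto simp: parity_level_def le_Suc_eq)
  moreover have "(parity_level k :: 'n set set) \<inter> {w. card w = Suc (Suc k)} = {}"
    by (auto simp: parity_level_def)
  ultimately have "card (parity_level (Suc (Suc k)) :: 'n set set) =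
      card (parity_level k :: 'n set set) + (Suc m choose Suc (Suc k))"
    by (simp add: card_Un_disjoint card_subsets_UNIV m)
  then show ?case
    using ge2 by (simp add: m)
qed

lemma card_parity_level_pos: "card (parity_level k :: 'n::finite set set) > 0"
  unfolding card_parity_level by (simp add: sum.atLeast_Suc_atMost)

lemma parity_kernel_self: "parity_kernel k x x = real (card (parity_level k :: 'n set set))"
  for x :: "bit ^ 'n::finite"
  by (simp add: parity_kernel_def)

text \<open>All weights involved have the parity of \<open>k\<close>, so every term acquires the
  same sign.\<close>

lemma parity_kernel_antipode:
  "parity_kernel k x (x + 1) = (- 1) ^ k * real (card (parity_level k :: 'n set set))"
  for x :: "bit ^ 'n::finite"
proof -
  have "chi w x * chi w (x + 1) = (- 1) ^ k" if "w \<in> parity_level k" for w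
  proof -
    have "(- 1 :: real) ^ card w = (- 1) ^ k"
      using that by (auto simp: parity_level_def minus_one_power_iff)
    then show ?thesis
      by (simp add: chi_antipode mult.left_commute)
  qed
  then show ?thesis
    by (simp add: parity_kernel_def)
qed

lemma parity_level_sym_diff:
  fixes w v :: "'n::finite set"
  assumes "w \<in> parity_level k" "v \<in> parity_level k"
  shows "even (card (sym_diff w v))" "card (sym_diff w v) \<le> 2 * k"
proof -
  have card: "card (sym_diff w v) + 2 * card (w \<inter> v) = card w + card v"
    by (rule card_sym_diff) simp_all
  have "even (card (sym_diff w v) + 2 * card (w \<inter> v))"
    using assms unfolding card parity_level_def by auto
  then show "even (card (sym_diff w v))"
    by simp
  show "card (sym_diff w v) \<le> 2 * k"
    using assms card unfolding parity_level_def by simp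
qed

text \<open>The weight \<open>g\<close> is taken to be constant 1 for (k,k)-designs and a single
  coordinate sign for (2k+1)-designs.\<close>

lemma sum_weighted_parity_kernel_square:
  fixes C :: "(bit ^ 'n::finite) set"
  shows "(\<Sum>y\<in>C. g y * (parity_kernel k x y)\<^sup>2) =
    (\<Sum>w\<in>parity_level k. \<Sum>v\<in>parity_level k.
      chi w x * chi v x * (\<Sum>y\<in>C. g y * chi (sym_diff w v) y))"
proof -
  have "g y * (parity_kernel k x y)\<^sup>2 = (\<Sum>w\<in>parity_level k. \<Sum>v\<in>parity_level k.
      chi w x * chi v x * (g y * chi (sym_diff w v) y))" for y
    by (simp add: parity_kernel_def power2_eq_square sum_product sum_distrib_left chi_sym_diff mult_ac)
  then have "(\<Sum>y\<in>C. g y * (parity_kernel k x y)\<^sup>2) =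
      (\<Sum>y\<in>C. \<Sum>w\<in>parity_level k. \<Sum>v\<in>parity_level k.
        chi w x * chi v x * (g y * chi (sym_diff w v) y))"
    by simp
  also have "\<dots> = (\<Sum>w\<in>parity_level k. \<Sum>y\<in>C. \<Sum>v\<in>parity_level k.
        chi w x * chi v x * (g y * chi (sym_diff w v) y))"
    by (rule sum.swap)
  also have "\<dots> = (\<Sum>w\<in>parity_level k. \<Sum>v\<in>parity_level k. \<Sum>y\<in>C.
        chi w x * chi v x * (g y * chi (sym_diff w v) y))"
    by (intro sum.cong refl sum.swap)
  finally show ?thesis
    by (simp add: sum_distrib_left)
qed

text \<open>Off the diagonal \<open>w = v\<close>, the product character is nontrivial of even
  weight at most 2k and sums to zero over \<open>C\<close>.\<close>

lemma sum_parity_kernel_square: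
  fixes C :: "(bit ^ 'n::finite) set"
  assumes "is_kk_design k C" "2 * k \<le> CARD('n)"
  shows "(\<Sum>y\<in>C. (parity_kernel k x y)\<^sup>2) =
    real (card C) * real (card (parity_level k :: 'n set set))"
proof -
  have char_sum: "char_sum (sym_diff w v) C = (if w = v then real (card C) else 0)"
    if "w \<in> parity_level k" "v \<in> parity_level k" for w v :: "'n set"
  proof (cases "w = v")
    case True
    then show ?thesis
      by (simp add: char_sum_def)
  next
    case False
    then have "sym_diff w v \<noteq> {}"
      by auto
    then show ?thesis
      using assms parity_level_sym_diff[OF that] False by (simp add: is_kk_design_iff)
  qed
  have "(\<Sum>y\<in>C. (parity_kernel k x y)\<^sup>2) = (\<Sum>w\<in>parity_level k. \<Sum>v\<in>parity_level k.
      chi w x * chi v x * char_sum (sym_diff w v) C)"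
    using sum_weighted_parity_kernel_square[of "\<lambda>_. 1" k x C] by (simp add: char_sum_def)
  also have "\<dots> = (\<Sum>w\<in>(parity_level k :: 'n set set). \<Sum>v\<in>parity_level k.
      if w = v then real (card C) else 0)"
    by (intro sum.cong refl) (simp add: char_sum)
  finally show ?thesis
    by simp
qed

text \<open>Up to the factor n, the inner product is a sum of characters of weight 1, which raises
  the weights in the squared kernel to at most 2k + 1.\<close>

lemma sum_inner_parity_kernel_square:
  fixes C :: "(bit ^ 'n::finite) set"
  assumes "is_design (2 * k + 1) C"
  shows "(\<Sum>y\<in>C. ham_inner x y * (parity_kernel k x y)\<^sup>2) = 0"
proof -
  have vanish: "char_sum u C = 0" if "u \<noteq> {}" "card u \<le> 2 * k + 1" for u
    using assms that by (simp add: is_design_iff)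
  have zero: "(\<Sum>y\<in>C. bsign y j * chi (sym_diff w v) y) = 0"
    if "w \<in> parity_level k" "v \<in> parity_level k" for w v :: "'n set" and j
  proof -
    let ?u = "sym_diff {j} (sym_diff w v)"
    have card: "card ?u + 2 * card ({j} \<inter> sym_diff w v) = 1 + card (sym_diff w v)"
      using card_sym_diff[of "{j}" "sym_diff w v"] by simp
    \<comment> \<open>Toggling one element of an even set gives an odd one, so the trivial character
      never occurs.\<close>
    then have "odd (card ?u + 2 * card ({j} \<inter> sym_diff w v))"
      using parity_level_sym_diff(1)[OF that] by presburger
    then have "?u \<noteq> {}"
      by (metis card.empty even_add even_mult_iff even_zero even_numeral)
    moreover have "card ?u \<le> 2 * k + 1"
      using parity_level_sym_diff(2)[OF that] card by linarith
    ultimately have "char_sum ?u C = 0"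
      by (rule vanish)
    then show ?thesis
      unfolding char_sum_def chi_sym_diff[of "{j}"] chi_singleton .
  qed
  have "real CARD('n) * (\<Sum>y\<in>C. ham_inner x y * (parity_kernel k x y)\<^sup>2) =
      (\<Sum>y\<in>C. (\<Sum>j\<in>UNIV. bsign (x + y) j) * (parity_kernel k x y)\<^sup>2)"
    unfolding sum_bsign by (simp add: sum_distrib_left mult.assoc)
  also have "\<dots> = (\<Sum>y\<in>C. \<Sum>j\<in>UNIV. bsign x j * (bsign y j * (parity_kernel k x y)\<^sup>2))"
    by (simp add: sum_distrib_right bsign_add mult.assoc)
  also have "\<dots> = (\<Sum>j\<in>UNIV. bsign x j * (\<Sum>y\<in>C. bsign y j * (parity_kernel k x y)\<^sup>2))"
    by (subst sum.swap) (simp add: sum_distrib_left)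
  also have "\<dots> = 0"
    by (simp add: sum_weighted_parity_kernel_square zero)
  finally show ?thesis
    by simp
qed

section \<open>Tight designs\<close>

lemma ham_inner_self [simp]: "ham_inner x x = 1"
  by (simp add: ham_inner_def hamming_dist_def)

lemma ham_inner_ge: "ham_inner x y \<ge> - 1"
  for x y :: "bit ^ 'n::finite"
proof -
  have "hamming_dist x y \<le> CARD('n)"
    by (simp add: hamming_dist_def card_mono)
  then show ?thesis
    by (simp add: ham_inner_def field_simps)
qed

lemma ham_inner_eq_minus_1_imp:
  fixes x y :: "bit ^ 'n::finite"
  assumes "ham_inner x y = - 1"
  shows "y = x + 1"
proof -
  have "card {j. x $ j \<noteq> y $ j} = CARD('n)"
    using assms by (simp add: ham_inner_def hamming_dist_def field_simps)
  then have "{j. x $ j \<noteq> y $ j} = UNIV"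
    by (intro card_subset_eq) auto
  then have neq: "x $ j \<noteq> y $ j" for j
    by auto
  have "y $ j = x $ j + 1" for j
    using neq[of j] by (cases "x $ j"; cases "y $ j") simp_all
  then show ?thesis
    by (simp add: vec_eq_iff)
qed

lemma antipode_neq: "x + 1 \<noteq> x" for x :: "bit ^ 'n::finite"
  by (simp add: vec_eq_iff)

section \<open>Antipodal pairs in tight designs\<close>

lemma tight_kk_design_antipode:
  fixes C :: "(bit ^ 'n::finite) set"
  assumes "tight_kk_design k C" "2 * k \<le> CARD('n)" "x \<in> C"
  shows "x + 1 \<notin> C"
proof
  assume "x + 1 \<in> C"
  let ?S = "real (card (parity_level k :: 'n set set))"
  have design: "is_kk_design k C" and card: "real (card C) = ?S"
    using assms(1) by (simp_all add: tight_kk_design_def card_parity_level)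
  have "(\<Sum>y\<in>{x, x + 1}. (parity_kernel k x y)\<^sup>2) \<le> (\<Sum>y\<in>C. (parity_kernel k x y)\<^sup>2)"
    using \<open>x \<in> C\<close> \<open>x + 1 \<in> C\<close> by (intro sum_mono2) auto
  also have "\<dots> = ?S\<^sup>2"
    using sum_parity_kernel_square[OF design assms(2)] card by (simp add: power2_eq_square)
  finally have "2 * ?S\<^sup>2 \<le> ?S\<^sup>2"
    using antipode_neq[of x]
    by (simp add: parity_kernel_self parity_kernel_antipode power_mult_distrib flip: power_mult)
  then show False
    using card_parity_level_pos[where 'n = 'n, of k] by (simp add: power2_eq_square)
qed

lemma tight_odd_design_antipode:
  fixes C :: "(bit ^ 'n::finite) set"
  assumes "tight_odd_design k C" "2 * k \<le> CARD('n)" "x \<in> C"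
  shows "x + 1 \<in> C"
proof (rule ccontr)
  assume antipode: "x + 1 \<notin> C"
  let ?S = "real (card (parity_level k :: 'n set set))"
  \<comment> \<open>The factor \<open>1 + ham_inner x y\<close> is nonnegative, equals 2 at
    \<open>y = x\<close>, and vanishes only at the antipode.\<close>
  let ?f = "\<lambda>y. (1 + ham_inner x y) * (parity_kernel k x y)\<^sup>2"
  have design: "is_design (2 * k + 1) C" and card: "real (card C) = 2 * ?S"
    using assms(1) by (simp_all add: tight_odd_design_def card_parity_level)
  have sum: "(\<Sum>y\<in>C. (parity_kernel k x y)\<^sup>2) = 2 * ?S\<^sup>2"
    using sum_parity_kernel_square[OF is_design_imp_is_kk_design[OF design assms(2)] assms(2)] card
    by (simp add: power2_eq_square)
  have "sum ?f C = 2 * ?S\<^sup>2"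
    using sum sum_inner_parity_kernel_square[OF design, of x] by (simp add: distrib_right sum.distrib)
  moreover have "sum ?f C = ?f x + sum ?f (C - {x})"
    using \<open>x \<in> C\<close> by (simp add: sum.remove)
  ultimately have "sum ?f (C - {x}) = 0"
    by (simp add: parity_kernel_self)
  moreover have "?f y \<ge> 0" for y
    using ham_inner_ge[of x y] by simp
  ultimately have zero: "?f y = 0" if "y \<in> C - {x}" for y
    using sum_nonneg_eq_0_iff[of "C - {x}" ?f] that by simp
  have "parity_kernel k x y = 0" if "y \<in> C - {x}" for y
  proof -
    have "ham_inner x y \<noteq> - 1"
      using that antipode ham_inner_eq_minus_1_imp[of x y] by auto
    then show ?thesis
      using zero[OF that] by auto
  qed
  \<comment> \<open>Without the antipode the sum is only half of the value forced by
    \<open>sum\<close>.\<close>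
  then have "(\<Sum>y\<in>C. (parity_kernel k x y)\<^sup>2) = (parity_kernel k x x)\<^sup>2"
    using \<open>x \<in> C\<close> by (simp add: sum.remove)
  then show False
    using sum card_parity_level_pos[where 'n = 'n, of k] by (simp add: parity_kernel_self)
qed

lemma tight_odd_design_from_kk:
  fixes D :: "(bit ^ 'n::finite) set"
  assumes D: "tight_kk_design k D" and k: "2 * k \<le> CARD('n)"
  shows "tight_odd_design k (D \<union> (\<lambda>x. x + 1) ` D)"
proof -
  let ?A = "(\<lambda>x. x + 1) ` D"
  have disj: "D \<inter> ?A = {}"
    using tight_kk_design_antipode[OF D k] by auto
  have "char_sum w (D \<union> ?A) = char_sum w D + char_sum w ?A" for w
    using disj by (simp add: char_sum_def sum.union_disjoint)
  then have "char_sum w (D \<union> ?A) = (1 + (- 1) ^ card w) * char_sum w D" for w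
    by (simp add: char_sum_antipode distrib_right)
  \<comment> \<open>Odd weights cancel; an even weight at most 2k + 1 is at most 2k, where
    \<open>D\<close> already has zero sum.\<close>
  then have "char_sum w (D \<union> ?A) = 0" if "w \<noteq> {}" "card w \<le> 2 * k + 1" for w
    using that D k
    by (cases "even (card w)") (auto simp: tight_kk_design_def is_kk_design_iff le_Suc_eq)
  moreover have "card ?A = card D"
    by (simp add: card_image inj_on_def)
  ultimately show ?thesis
    using D disj
    by (auto simp: tight_kk_design_def is_kk_design_def tight_odd_design_def is_design_iff
        card_Un_disjoint)
qed

text \<open>Any coordinate \<open>j\<close> serves: it differs at antipodes, so it selects exactly
  one point from each antipodal pair of \<open>C\<close>.\<close>

lemma tight_kk_design_from_odd:
  fixes C :: "(bit ^ 'n::finite) set"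
  assumes C: "tight_odd_design k C" and k: "2 * k \<le> CARD('n)"
  shows "tight_kk_design k {x \<in> C. x $ j = 0}"
proof -
  let ?D = "{x \<in> C. x $ j = 0}"
  let ?A = "(\<lambda>x. x + 1) ` ?D"
  have "?A = {x \<in> C. x $ j = 1}"
  proof (intro equalityI subsetI)
    fix x assume x: "x \<in> {x \<in> C. x $ j = 1}"
    then have "x + 1 \<in> C"
      by (intro tight_odd_design_antipode[OF C k]) simp
    then have "x + 1 \<in> ?D"
      using x by simp
    then have "x + 1 + 1 \<in> ?A"
      by (rule imageI)
    then show "x \<in> ?A"
      by simp
  next
    fix x assume "x \<in> ?A"
    then obtain y where y: "y \<in> ?D" "x = y + 1"
      by blast
    then have "x \<in> C"
      using tight_odd_design_antipode[OF C k, of y] by simp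
    then show "x \<in> {x \<in> C. x $ j = 1}"
      using y by simp
  qed
  then have union: "C = ?D \<union> ?A" and disj: "?D \<inter> ?A = {}"
    by auto
  have "char_sum w C = char_sum w ?D + char_sum w ?A" for w
    unfolding char_sum_def using disj by (subst union, intro sum.union_disjoint) auto
  then have "char_sum w C = (1 + (- 1) ^ card w) * char_sum w ?D" for w
    by (simp add: char_sum_antipode distrib_right)
  \<comment> \<open>At even weight the factor is 2, so the vanishing passes from \<open>C\<close> to
    \<open>?D\<close>.\<close>
  then have char_sum: "char_sum w ?D = 0" if "w \<noteq> {}" "even (card w)" "card w \<le> 2 * k" for w
    using that C by (auto simp: tight_odd_design_def is_design_iff)
  have "card ?A = card ?D"
    by (simp add: card_image inj_on_def)
  then have "card C = 2 * card ?D"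
    using disj by (subst union) (simp add: card_Un_disjoint)
  moreover have "?D \<noteq> {}"
    using C union by (auto simp: tight_odd_design_def is_design_def)
  ultimately show ?thesis
    using C k char_sum by (simp add: tight_odd_design_def tight_kk_design_def is_kk_design_iff)
qed

theorem theorem5p1:
  fixes k :: nat
  assumes "1 \<le> k" and "real k \<le> real CARD('n::finite) / 2"
  shows "(\<exists>C :: (bit ^ 'n) set. tight_kk_design k C) \<longleftrightarrow>
         (\<exists>C :: (bit ^ 'n) set. tight_odd_design k C)"
proof -
  have "2 * k \<le> CARD('n)"
    using assms(2) by linarith
  then show ?thesis
    using tight_odd_design_from_kk tight_kk_design_from_odd by blast
qed

end
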